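(* Let $\theta>0$, $0\le\alpha<1$, $n\ge1$, and consider the down-up walk with parameters $\theta,\alpha$ on the $n$th level of the Kingman lattice. Let $s^*(r)$ be its maximal separation distance after $r$ steps. Then for all integers $r\ge0$, $s^*(r)=\mathbb{P}(T>r)$, where $T$ is the sum of independent geometric random variables with parameters $\frac{i(\theta+i-1)}{n(\theta+n-1)}$ for $2\le i\le n$.
   Context: For a partition $\lambda$, $m_k(\lambda)$ is the number of parts (rows) of size $k$ and $l(\lambda)$ the number of parts. Down chain: from a partition $\lambda$ of $n$, for each $j\ge1$ with $m_j(\lambda)>0$, remove a box from a row of length $j$ (replace a part $j$ by $j-1$) with probability $\frac{j\,m_j(\lambda)}{n}$, obtaining a partition of $n-1$. Up chain: from a partition $\lambda$ of $n$, for each $k\ge1$ add a box to a row of length $k$ (replace a part $k$ by $k+1$) with probability $\frac{(k-\alpha)m_k(\lambda)}{\theta+n}$, and add a new part of size $1$ with probability $\frac{\theta+\alpha l(\lambda)}{\theta+n}$, obtaining a partition of $n+1$. The down-up walk on the $n$th level of the Kingman lattice is the Markov chain $K$ on partitions of $n$ taking one down step (to a partition of $n-1$) and then one up step. Its stationary distribution is the Pitman distribution $$\pi(\lambda)=\frac{\theta(\theta+\alpha)\cdots(\theta+(l(\lambda)-1)\alpha)}{\theta(\theta+1)\cdots(\theta+n-1)}\,\frac{n!}{\prod_k m_k(\lambda)!\prod_{i=1}^{l(\lambda)}\lambda_i!}\prod_{(i,j)\in\lambda,\ j\ge2}(j-1-\alpha),$$ the last product being over boxes $(i,j)$ (row $i$,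 column $j$) of the diagram of $\lambda$. The maximal separation distance is $s^*(r)=\max_{x,y}\left[1-\frac{K^r(x,y)}{\pi(y)}\right]$. A geometric random variable $X$ with parameter $p\in(0,1]$ satisfies $\mathbb{P}(X=m)=p(1-p)^{m-1}$ for $m\ge1$. An empty sum is $0$. *)

theory Defs
  imports "HOL-Probability.Probability" "HOL-Library.Multiset"
begin

text \<open>An integer partition is the multiset of its (positive) parts, so that
  \<^term>\<open>count l k\<close> is the number of parts of size \<open>k\<close> and \<^term>\<open>size l\<close> is the number of parts.\<close>

definition partitions :: "nat \<Rightarrow> nat multiset set" where
  "partitions n = {l. 0 \<notin># l \<and> sum_mset l = n}"

lemma finite_partitions: "finite (partitions n)"
proof (rule finite_subset)
  show "partitions n \<subseteq> mset ` {xs. set xs \<subseteq> {..n} \<and> length xs \<le> n}"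
  proof
    fix l assume l: "l \<in> partitions n"
    obtain xs where xs: "mset xs = l" using ex_mset by blast
    have pos: "0 \<notin> set xs" and sum: "sum_list xs = n"
      using l xs by (auto simp: partitions_def simp flip: sum_mset_sum_list)
    have "length ys \<le> sum_list ys" if "0 \<notin> set ys" for ys :: "nat list"
      using that by (induction ys) auto
    with pos sum have "length xs \<le> n" by blast
    moreover have "set xs \<subseteq> {..n}"
      using member_le_sum_list[of _ xs] sum by auto
    ultimately show "l \<in> mset ` {xs. set xs \<subseteq> {..n} \<and> length xs \<le> n}"
      using xs by blast
  qed
  show "finite (mset ` {xs. set xs \<subseteq> {..n} \<and> length xs \<le> n})"
    using finite_lists_length_le[of "{..n}" n] by simp
qed

text \<open>Removing the only box of a row of length 1 deletes the row.\<close>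

definition remove_box :: "nat \<Rightarrow> nat multiset \<Rightarrow> nat multiset" where
  "remove_box j l = (l - {#j#}) + (if j = 1 then {#} else {#j - 1#})"

definition add_box :: "nat \<Rightarrow> nat multiset \<Rightarrow> nat multiset" where
  "add_box k l = (l - {#k#}) + {#k + 1#}"

text \<open>Transition probabilities from a partition \<open>l\<close> of \<open>n\<close> to a partition of \<open>n - 1\<close>,
  respectively of \<open>n + 1\<close>.\<close>

definition down_prob :: "nat \<Rightarrow> nat multiset \<Rightarrow> nat multiset \<Rightarrow> real" where
  "down_prob n l m =
     (\<Sum>j\<in>set_mset l. if m = remove_box j l then real j * real (count l j) / real n else 0)"

definition up_prob :: "real \<Rightarrow> real \<Rightarrow> nat \<Rightarrow> nat multiset \<Rightarrow> nat multiset \<Rightarrow> real" where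
  "up_prob \<theta> \<alpha> n l m =
     (\<Sum>k\<in>set_mset l. if m = add_box k l
        then (real k - \<alpha>) * real (count l k) / (\<theta> + real n) else 0)
     + (if m = add_mset 1 l then (\<theta> + \<alpha> * real (size l)) / (\<theta> + real n) else 0)"

definition down_up_walk :: "real \<Rightarrow> real \<Rightarrow> nat \<Rightarrow> nat multiset \<Rightarrow> nat multiset \<Rightarrow> real" where
  "down_up_walk \<theta> \<alpha> n l m =
     (\<Sum>k\<in>partitions (n - 1). down_prob n l k * up_prob \<theta> \<alpha> (n - 1) k m)"

definition pitman :: "real \<Rightarrow> real \<Rightarrow> nat \<Rightarrow> nat multiset \<Rightarrow> real" where
  "pitman \<theta> \<alpha> n l =
     (\<Prod>i<size l. \<theta> + real i * \<alpha>) / pochhammer \<theta> n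
     * (fact n / ((\<Prod>k\<in>set_mset l. fact (count l k)) * (\<Prod>p\<in>#l. fact p)))
     * (\<Prod>p\<in>#l. \<Prod>j\<in>{2..p}. real j - 1 - \<alpha>)"

primrec kernel_power ::
  "'s set \<Rightarrow> ('s \<Rightarrow> 's \<Rightarrow> real) \<Rightarrow> nat \<Rightarrow> 's \<Rightarrow> 's \<Rightarrow> real" where
  "kernel_power S K 0 x y = (if x = y then 1 else 0)"
| "kernel_power S K (Suc r) x y = (\<Sum>z\<in>S. K x z * kernel_power S K r z y)"

definition max_separation ::
  "'s set \<Rightarrow> ('s \<Rightarrow> 's \<Rightarrow> real) \<Rightarrow> ('s \<Rightarrow> real) \<Rightarrow> nat \<Rightarrow> real" where
  "max_separation S K \<pi> r = Max {1 - kernel_power S K r x y / \<pi> y | x y. x \<in> S \<and> y \<in> S}"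

text \<open>The number of trials, rather than the number of failures as in \<^const>\<open>geometric_pmf\<close>;
  for \<open>0 < p \<le> 1\<close> the values at \<open>m \<ge> 1\<close> have total mass 1.\<close>

definition geometric_rv :: "'a measure \<Rightarrow> real \<Rightarrow> ('a \<Rightarrow> nat) \<Rightarrow> bool" where
  "geometric_rv M p X \<longleftrightarrow> X \<in> measurable M (count_space UNIV) \<and>
     (\<forall>m\<ge>1. measure M {\<omega> \<in> space M. X \<omega> = m} = p * (1 - p) ^ (m - 1))"

end

theory Submission
  imports Defs
begin

text \<open>Write \<open>D\<close> and \<open>U\<close> for the down and up chains, acting on functions of partitions. Moves on
  different rows commute, so on level \<open>m\<close> one has \<open>U D = a D U + (1 - a) I\<close> with
  \<open>a = m (\<theta> + m - 1) / ((m + 1) (\<theta> + m))\<close>. Hence the walk \<open>K = D U\<close> on level \<open>n\<close> satisfies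
  \<open>K B\<^sub>k = p B\<^sub>k\<^sub>+\<^sub>1 + (1 - p) B\<^sub>k\<close> for \<open>B\<^sub>k = D\<^sup>k U\<^sup>k\<close>, where
  \<open>p = i (\<theta> + i - 1) / (n (\<theta> + n - 1))\<close> and \<open>i = n - k\<close>. Since all rows of \<open>B\<^sub>n\<^sub>-\<^sub>1\<close> equal the Pitman
  distribution \<open>\<pi>\<close>, it follows that \<open>K\<^sup>r = P(T \<le> r) \<pi> + (nonnegative combination of B\<^sub>k, k \<le> n - 2)\<close>.
  This bounds the separation by \<open>P(T > r)\<close>. Equality holds for the one-row partition as starting
  state and the one-column partition as final state: \<open>B\<^sub>k\<close> retains a row of length at least 2
  if \<open>k \<le> n - 2\<close>.\<close>

section \<open>Sums over multisets\<close>

text \<open>The kernels sum over row lengths weighted by multiplicity, the operators below over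
  individual rows; this passes between the two and makes the rules for finite sums
  available.\<close>

lemma sum_mset_image_eq_sum_count:
  fixes f :: "'a \<Rightarrow> real"
  shows "(\<Sum>x\<in>#l. f x) = (\<Sum>x\<in>set_mset l. real (count l x) * f x)"
proof -
  \<comment> \<open>A fixed finite index set \<open>S\<close> keeps the range of summation unchanged
    while \<open>l\<close> grows in the induction.\<close>
  have "(\<Sum>x\<in>#l. f x) = (\<Sum>x\<in>S. real (count l x) * f x)"
    if "finite S" "set_mset l \<subseteq> S" for S
    using that(2)
  proof (induction l)
    case (add a l)
    then have "a \<in> S" by simp
    have "(\<Sum>x\<in>S. real (count (add_mset a l) x) * f x)
        = (\<Sum>x\<in>S. (if x = a then f x else 0) + real (count l x) * f x)"
      by (intro sum.cong) (auto simp: algebra_simps)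
    also have "\<dots> = f a + (\<Sum>x\<in>S. real (count l x) * f x)"
      using \<open>finite S\<close> \<open>a \<in> S\<close> by (simp add: sum.distrib)
    finally show ?case using add by simp
  qed simp
  from this[of "set_mset l"] show ?thesis by simp
qed

text \<open>Both sides run over ordered pairs of distinct rows, that is, over all pairs minus the
  diagonal. It matches the terms where two different rows move, once in each order.\<close>

lemma sum_mset_remove_swap:
  fixes h :: "'a \<Rightarrow> 'a \<Rightarrow> real"
  shows "(\<Sum>a\<in>#l. \<Sum>b\<in>#l - {#a#}. h a b) = (\<Sum>b\<in>#l. \<Sum>a\<in>#l - {#b#}. h a b)"
proof -
  have remove: "(\<Sum>b\<in>#l - {#a#}. g b) = (\<Sum>b\<in>#l. g b) - g a" if "a \<in># l" for a and g :: "'a \<Rightarrow> real"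
    using that by (metis (no_types, lifting) add_diff_cancel_left' image_mset_add_mset insert_DiffM sum_mset.insert)
  have "(\<Sum>a\<in>#l. \<Sum>b\<in>#l - {#a#}. h a b) = (\<Sum>a\<in>#l. (\<Sum>b\<in>#l. h a b) - h a a)"
    by (intro arg_cong[of _ _ sum_mset] image_mset_cong) (simp add: remove)
  also have "\<dots> = (\<Sum>a\<in>#l. \<Sum>b\<in>#l. h a b) - (\<Sum>a\<in>#l. h a a)"
    by (simp add: sum_mset_image_eq_sum_count right_diff_distrib sum_subtractf)
  also have "(\<Sum>a\<in>#l. \<Sum>b\<in>#l. h a b) = (\<Sum>b\<in>#l. \<Sum>a\<in>#l. h a b)"
    by (rule sum_mset.swap)
  also have "(\<Sum>b\<in>#l. \<Sum>a\<in>#l. h a b) - (\<Sum>a\<in>#l. h a a) = (\<Sum>b\<in>#l. (\<Sum>a\<in>#l. h a b) - h b b)"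
    by (simp add: sum_mset_image_eq_sum_count right_diff_distrib sum_subtractf)
  also have "\<dots> = (\<Sum>b\<in>#l. \<Sum>a\<in>#l - {#b#}. h a b)"
    by (intro arg_cong[of _ _ sum_mset] image_mset_cong) (simp add: remove)
  finally show ?thesis .
qed

lemma size_mset_le_sum_mset: "0 \<notin># l \<Longrightarrow> size l \<le> sum_mset l" for l :: "nat multiset"
  by (induction l) auto

section \<open>The chains as operators on functions\<close>

text \<open>The expected value of \<open>f\<close> after one down step. Dividing by
  \<open>sum_mset l\<close> instead of a level parameter lets the operator be iterated across
  levels.\<close>

definition down_op :: "(nat multiset \<Rightarrow> real) \<Rightarrow> nat multiset \<Rightarrow> real" where
  "down_op f l = (\<Sum>j\<in>#l. real j * f (remove_box j l)) / real (sum_mset l)"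

definition up_op :: "real \<Rightarrow> real \<Rightarrow> (nat multiset \<Rightarrow> real) \<Rightarrow> nat multiset \<Rightarrow> real" where
  "up_op \<theta> \<alpha> f l =
     ((\<Sum>k\<in>#l. (real k - \<alpha>) * f (add_box k l)) + (\<theta> + \<alpha> * real (size l)) * f (add_mset 1 l))
       / (\<theta> + real (sum_mset l))"

lemma remove_box_partitions:
  assumes "l \<in> partitions n" "j \<in># l"
  shows "remove_box j l \<in> partitions (n - 1)"
proof -
  obtain w where w: "l = add_mset j w" using multi_member_split[OF assms(2)] by blast
  from assms show ?thesis by (auto simp: partitions_def remove_box_def w)
qed

lemma add_box_partitions:
  assumes "l \<in> partitions n" "k \<in># l"
  shows "add_box k l \<in> partitions (Suc n)"
proof -
  obtain w where w: "l = add_mset k w" using multi_member_split[OF assms(2)] by blast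
  from assms show ?thesis by (auto simp: partitions_def add_box_def w)
qed

lemma add_mset_1_partitions: "l \<in> partitions n \<Longrightarrow> add_mset 1 l \<in> partitions (Suc n)"
  by (simp add: partitions_def)

text \<open>The sum over target states collapses because each \<open>remove_box j l\<close> is a
  single state of the level below.\<close>

lemma sum_down_prob:
  assumes "l \<in> partitions n"
  shows "(\<Sum>z\<in>partitions (n - 1). down_prob n l z * f z) = down_op f l"
proof -
  have "(\<Sum>z\<in>partitions (n - 1). down_prob n l z * f z)
      = (\<Sum>j\<in>set_mset l. \<Sum>z\<in>partitions (n - 1).
           if z = remove_box j l then real j * real (count l j) / real n * f z else 0)"
    unfolding down_prob_def sum_distrib_right by (subst sum.swap) (intro sum.cong; simp)
  also have "\<dots> = (\<Sum>j\<in>set_mset l. real j * real (count l j) / real n * f (remove_box j l))"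
    using remove_box_partitions[OF assms] by (intro sum.cong) (simp_all add: finite_partitions)
  also have "\<dots> = down_op f l"
    using assms by (simp add: down_op_def partitions_def sum_mset_image_eq_sum_count
        sum_divide_distrib mult_ac)
  finally show ?thesis .
qed

lemma sum_up_prob:
  assumes "l \<in> partitions n"
  shows "(\<Sum>z\<in>partitions (Suc n). up_prob \<theta> \<alpha> n l z * f z) = up_op \<theta> \<alpha> f l"
proof -
  have "(\<Sum>z\<in>partitions (Suc n). up_prob \<theta> \<alpha> n l z * f z)
      = (\<Sum>k\<in>set_mset l. \<Sum>z\<in>partitions (Suc n).
           if z = add_box k l then (real k - \<alpha>) * real (count l k) / (\<theta> + real n) * f z else 0)
        + (\<Sum>z\<in>partitions (Suc n).
           if z = add_mset 1 l then (\<theta> + \<alpha> * real (size l)) / (\<theta> + real n) * f z else 0)"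
    unfolding up_prob_def sum_distrib_right distrib_right sum.distrib
    by (subst sum.swap) (intro arg_cong2[of _ _ _ _ "(+)"] sum.cong; simp)
  also have "\<dots> = (\<Sum>k\<in>set_mset l. (real k - \<alpha>) * real (count l k) / (\<theta> + real n) * f (add_box k l))
        + (\<theta> + \<alpha> * real (size l)) / (\<theta> + real n) * f (add_mset 1 l)"
    using assms add_mset_1_partitions[OF assms]
    by (intro arg_cong2[of _ _ _ _ "(+)"] sum.cong)
      (simp_all add: finite_partitions add_box_partitions)
  also have "\<dots> = up_op \<theta> \<alpha> f l"
    using assms by (simp add: up_op_def partitions_def sum_mset_image_eq_sum_count
        sum_divide_distrib add_divide_distrib distrib_left distrib_right mult_ac)
  finally show ?thesis .
qed

text \<open>Only values on the adjacent level matter, so identities known on one level may be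
  substituted under the operator.\<close>

lemma down_op_cong:
  assumes "l \<in> partitions n" "\<And>z. z \<in> partitions (n - 1) \<Longrightarrow> f z = g z"
  shows "down_op f l = down_op g l"
  using assms by (auto simp: sum_down_prob[symmetric, OF assms(1)] intro!: sum.cong)

lemma up_op_cong:
  assumes "l \<in> partitions n" "\<And>z. z \<in> partitions (Suc n) \<Longrightarrow> f z = g z"
  shows "up_op \<theta> \<alpha> f l = up_op \<theta> \<alpha> g l"
  using assms by (auto simp: sum_up_prob[symmetric, OF assms(1)] intro!: sum.cong)

lemma down_op_linear: "down_op (\<lambda>l. a * f l + b * g l) l = a * down_op f l + b * down_op g l"
  by (simp add: down_op_def sum_mset_image_eq_sum_count algebra_simps sum.distrib
      sum_distrib_left add_divide_distrib)

lemma up_op_linear: "up_op \<theta> \<alpha> (\<lambda>l. a * f l + b * g l) l = a * up_op \<theta> \<alpha> f l + b * up_op \<theta> \<alpha> g l"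
  by (simp add: up_op_def sum_mset_image_eq_sum_count distrib_left sum.distrib
      sum_distrib_left add_divide_distrib mult_ac)

lemma down_op_nonneg:
  assumes "0 \<notin># l" "\<And>z. 0 \<notin># z \<Longrightarrow> 0 \<le> f z"
  shows "0 \<le> down_op f l"
proof -
  have "l \<in> partitions (sum_mset l)" using assms(1) by (simp add: partitions_def)
  then have "0 \<le> f (remove_box j l)" if "j \<in># l" for j
    using remove_box_partitions[OF _ that] assms(2) by (auto simp: partitions_def)
  then show ?thesis
    by (auto simp: down_op_def sum_mset_image_eq_sum_count intro!: sum_nonneg divide_nonneg_nonneg)
qed

text \<open>A row of length 0 would carry the weight \<open>- \<alpha>\<close>, so nonnegativity is
  assumed and obtained only on multisets of positive parts.\<close>

lemma up_op_nonneg: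
  assumes "0 < \<theta>" "0 \<le> \<alpha>" "\<alpha> < 1" "0 \<notin># l" "\<And>z. 0 \<notin># z \<Longrightarrow> 0 \<le> f z"
  shows "0 \<le> up_op \<theta> \<alpha> f l"
proof -
  have l: "l \<in> partitions (sum_mset l)" using assms(4) by (simp add: partitions_def)
  have "0 \<le> f (add_box j l)" if "j \<in># l" for j
    using add_box_partitions[OF l that] assms(5) by (auto simp: partitions_def)
  moreover have "0 \<le> real j - \<alpha>" if "j \<in># l" for j
    using that assms(3,4) by (cases j) auto
  moreover have "0 \<le> f (add_mset 1 l)"
    using assms(4,5) by simp
  ultimately show ?thesis
    using assms(1,2) by (auto simp: up_op_def sum_mset_image_eq_sum_count simp del: of_nat_sum_mset
        intro!: divide_nonneg_nonneg add_nonneg_nonneg sum_nonneg mult_nonneg_nonneg)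
qed

text \<open>The relation between \<open>U D\<close> and \<open>D U\<close> with denominators
  cleared. Moves on different rows commute and cancel; what remains are the moves that return to
  \<open>l\<close>, and their total weights differ by \<open>\<theta> + 2 * real n\<close>.\<close>

lemma up_op_down_op:
  assumes l: "l \<in> partitions n" and n: "n \<ge> 1" and \<theta>: "0 < \<theta>"
  shows "(real n + 1) * (\<theta> + real n) * up_op \<theta> \<alpha> (down_op f) l
     = real n * (\<theta> + real n - 1) * down_op (up_op \<theta> \<alpha> f) l + (\<theta> + 2 * real n) * f l"
proof -
  \<comment> \<open>\<open>rest j\<close> is what a row of length \<open>j\<close> leaves after
    losing a box; \<open>h k j\<close> and \<open>e j\<close> are the values of \<open>f\<close>
    when a box of row \<open>j\<close> goes to another row \<open>k\<close> or to a new row.\<close>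
  define rest where "rest j = (if j = 1 then {#} else {#j - 1 :: nat#})" for j
  define h where "h k j = f (l - {#k#} - {#j#} + rest j + {#k + 1#})" for k j
  define e where "e j = f (add_mset 1 (remove_box j l))" for j
  have sum_l: "sum_mset l = n" and zero: "0 \<notin># l" using l by (auto simp: partitions_def)
  have pos: "\<theta> + real n - 1 > 0" using n \<theta> by linarith
  have down_Suc: "(real n + 1) * down_op f z = (\<Sum>j\<in>#z. real j * f (remove_box j z))"
    if "sum_mset z = n + 1" for z
    by (simp add: down_op_def that add.commute[of _ "1 :: real"])
  \<comment> \<open>Removing from the row just lengthened returns to \<open>l\<close> with weight
    \<open>k + 1\<close>; any other row gives an \<open>h\<close> term.\<close>
  have up_then_down: "(real n + 1) * down_op f (add_box k l)
      = (real k + 1) * f l + (\<Sum>j\<in>#l - {#k#}. real j * h k j)" if "k \<in># l" for k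
  proof -
    obtain w where w: "l = add_mset k w" using multi_member_split[OF \<open>k \<in># l\<close>] by blast
    have "k \<noteq> 0" using zero that by metis
    have "remove_box j (add_box k l) = l - {#k#} - {#j#} + rest j + {#k + 1#}" if "j \<in># w" for j
    proof -
      obtain v where v: "w = add_mset j v" using multi_member_split[OF \<open>j \<in># w\<close>] by blast
      show ?thesis by (auto simp: w v remove_box_def add_box_def rest_def add_mset_commute)
    qed
    then have "(\<Sum>j\<in>#w. real j * f (remove_box j (add_box k l))) = (\<Sum>j\<in>#w. real j * h k j)"
      by (intro arg_cong[of _ _ sum_mset] image_mset_cong) (simp add: h_def)
    moreover have "remove_box (k + 1) (add_box k l) = l"
      using \<open>k \<noteq> 0\<close> by (simp add: w remove_box_def add_box_def)
    moreover have "add_box k l = add_mset (k + 1) w" by (simp add: w add_box_def)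
    moreover have "sum_mset (add_box k l) = n + 1"
      using sum_l by (simp add: w add_box_def)
    ultimately show ?thesis by (simp add: down_Suc w)
  qed
  have new_then_down: "(real n + 1) * down_op f (add_mset 1 l) = f l + (\<Sum>j\<in>#l. real j * e j)"
  proof -
    have "remove_box j (add_mset 1 l) = add_mset 1 (remove_box j l)" if "j \<in># l" for j
    proof -
      obtain w where w: "l = add_mset j w" using multi_member_split[OF \<open>j \<in># l\<close>] by blast
      show ?thesis by (simp add: w remove_box_def)
    qed
    then have "(\<Sum>j\<in>#l. real j * f (remove_box j (add_mset 1 l))) = (\<Sum>j\<in>#l. real j * e j)"
      by (intro arg_cong[of _ _ sum_mset] image_mset_cong) (simp add: e_def)
    moreover have "remove_box 1 (add_mset 1 l) = l" by (simp add: remove_box_def)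
    ultimately show ?thesis by (simp add: down_Suc sum_l)
  qed
  have down_then_up: "(\<theta> + real n - 1) * up_op \<theta> \<alpha> f (remove_box j l)
      = (\<Sum>k\<in>#l - {#j#}. (real k - \<alpha>) * h k j) + (real j - 1 - \<alpha>) * f l
        + (\<theta> + \<alpha> * real (size l)) * e j" if "j \<in># l" for j
  proof -
    obtain w where w: "l = add_mset j w" using multi_member_split[OF \<open>j \<in># l\<close>] by blast
    have "j \<noteq> 0" using zero that by metis
    have "remove_box j l \<in> partitions (n - 1)" by (rule remove_box_partitions[OF l that])
    then have sum_rb: "real (sum_mset (remove_box j l)) = real n - 1"
      using n by (simp add: partitions_def of_nat_diff)
    have "add_box k (remove_box j l) = l - {#k#} - {#j#} + rest j + {#k + 1#}" if "k \<in># w" for k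
    proof -
      obtain v where v: "w = add_mset k v" using multi_member_split[OF \<open>k \<in># w\<close>] by blast
      show ?thesis by (auto simp: w v remove_box_def add_box_def rest_def add_mset_commute)
    qed
    then have *: "(\<Sum>k\<in>#w. (real k - \<alpha>) * f (add_box k (remove_box j l)))
        = (\<Sum>k\<in>#w. (real k - \<alpha>) * h k j)"
      by (intro arg_cong[of _ _ sum_mset] image_mset_cong) (simp add: h_def)
    have "\<theta> + real (sum_mset (remove_box j l)) = \<theta> + real n - 1" unfolding sum_rb by simp
    then have up: "(\<theta> + real n - 1) * up_op \<theta> \<alpha> f (remove_box j l)
        = (\<Sum>k\<in>#remove_box j l. (real k - \<alpha>) * f (add_box k (remove_box j l)))
          + (\<theta> + \<alpha> * real (size (remove_box j l))) * e j"
      using pos by (simp add: up_op_def e_def add_diff_eq del: of_nat_sum_mset)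
    show ?thesis
    \<comment> \<open>If \<open>j = 1\<close> the row disappears and the new-row weight drops by
      \<alpha>; as \<open>e 1 = f l\<close>, this loss is exactly the term
      \<open>(real j - 1 - \<alpha>) * f l\<close>. If \<open>j > 1\<close>, that term comes from
      regrowing the shortened row.\<close>
    proof (cases "j = 1")
      case True
      then have "remove_box j l = w" by (simp add: w remove_box_def)
      moreover have "e j = f l" using True by (simp add: e_def w remove_box_def)
      ultimately show ?thesis
        using up * True by (simp add: w algebra_simps)
    next
      case False
      then have rb: "remove_box j l = add_mset (j - 1) w" by (simp add: w remove_box_def)
      have "add_box (j - 1) (remove_box j l) = l"
        using \<open>j \<noteq> 0\<close> by (simp add: rb) (simp add: w add_box_def)
      then have "(\<Sum>k\<in>#remove_box j l. (real k - \<alpha>) * f (add_box k (remove_box j l)))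
          = (real j - 1 - \<alpha>) * f l + (\<Sum>k\<in>#w. (real k - \<alpha>) * h k j)"
        using \<open>j \<noteq> 0\<close> * by (simp add: rb of_nat_diff)
      moreover have "size (remove_box j l) = size l" by (simp add: rb) (simp add: w)
      ultimately show ?thesis
        using up by (simp add: w)
    qed
  qed
  have "(real n + 1) * (\<theta> + real n) * up_op \<theta> \<alpha> (down_op f) l
      = (\<Sum>k\<in>#l. (real k - \<alpha>) * ((real n + 1) * down_op f (add_box k l)))
        + (\<theta> + \<alpha> * real (size l)) * ((real n + 1) * down_op f (add_mset 1 l))"
    using \<theta> by (simp add: up_op_def sum_l sum_mset_image_eq_sum_count sum_distrib_left field_simps)
  also have "\<dots> = (\<Sum>k\<in>#l. (real k - \<alpha>) * ((real k + 1) * f l + (\<Sum>j\<in>#l - {#k#}. real j * h k j)))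
        + (\<theta> + \<alpha> * real (size l)) * (f l + (\<Sum>j\<in>#l. real j * e j))"
    by (intro arg_cong2[of _ _ _ _ "(+)"] arg_cong[of _ _ sum_mset] image_mset_cong)
      (simp_all only: up_then_down new_then_down)
  also have "\<dots> = (\<Sum>k\<in>#l. \<Sum>j\<in>#l - {#k#}. (real k - \<alpha>) * real j * h k j)
        + (\<Sum>k\<in>#l. (real k - \<alpha>) * (real k + 1)) * f l
        + (\<theta> + \<alpha> * real (size l)) * (f l + (\<Sum>j\<in>#l. real j * e j))"
    by (simp add: sum_mset_distrib_left sum_mset_distrib_right distrib_left sum_mset.distrib mult_ac)
  finally have UD: "(real n + 1) * (\<theta> + real n) * up_op \<theta> \<alpha> (down_op f) l = \<dots>" .
  have "real n * (\<theta> + real n - 1) * down_op (up_op \<theta> \<alpha> f) l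
      = (\<Sum>j\<in>#l. real j * ((\<theta> + real n - 1) * up_op \<theta> \<alpha> f (remove_box j l)))"
  proof -
    have "real n * down_op (up_op \<theta> \<alpha> f) l = (\<Sum>j\<in>#l. real j * up_op \<theta> \<alpha> f (remove_box j l))"
      using n by (simp add: down_op_def sum_l)
    then have "(\<theta> + real n - 1) * (real n * down_op (up_op \<theta> \<alpha> f) l)
        = (\<theta> + real n - 1) * (\<Sum>j\<in>#l. real j * up_op \<theta> \<alpha> f (remove_box j l))"
      by simp
    then show ?thesis by (simp add: sum_mset_distrib_left mult_ac)
  qed
  also have "\<dots> = (\<Sum>j\<in>#l. real j * ((\<Sum>k\<in>#l - {#j#}. (real k - \<alpha>) * h k j)
        + (real j - 1 - \<alpha>) * f l + (\<theta> + \<alpha> * real (size l)) * e j))"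
    by (intro arg_cong[of _ _ sum_mset] image_mset_cong) (simp only: down_then_up)
  also have "\<dots> = (\<Sum>j\<in>#l. \<Sum>k\<in>#l - {#j#}. (real k - \<alpha>) * real j * h k j)
        + (\<Sum>j\<in>#l. real j * (real j - 1 - \<alpha>)) * f l
        + (\<theta> + \<alpha> * real (size l)) * (\<Sum>j\<in>#l. real j * e j)"
    by (simp add: sum_mset_distrib_left sum_mset_distrib_right distrib_left sum_mset.distrib mult_ac)
  finally have DU: "real n * (\<theta> + real n - 1) * down_op (up_op \<theta> \<alpha> f) l = \<dots>" .
  \<comment> \<open>Weights of returning to \<open>l\<close>: each row contributes
    \<open>2 * real k - \<alpha>\<close> to the difference, and \<open>\<alpha> * size l\<close>
    cancels against the weight of creating and deleting a new row.\<close>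
  have "(\<Sum>k\<in>#l. (real k - \<alpha>) * (real k + 1)) - (\<Sum>j\<in>#l. real j * (real j - 1 - \<alpha>))
      = (\<Sum>k\<in>#l. 2 * real k - \<alpha>)"
    by (simp add: sum_mset_image_eq_sum_count sum_subtractf[symmetric] algebra_simps)
  also have "\<dots> = 2 * real n - \<alpha> * real (size l)"
    unfolding sum_l[symmetric] by (induction l) (auto simp: algebra_simps)
  finally have diagonal: "(\<Sum>k\<in>#l. (real k - \<alpha>) * (real k + 1))
      = (\<Sum>j\<in>#l. real j * (real j - 1 - \<alpha>)) + (2 * real n - \<alpha> * real (size l))"
    by linarith
  show ?thesis
    unfolding UD DU diagonal by (subst sum_mset_remove_swap) (simp add: algebra_simps)
qed

section \<open>The Pitman distribution is preserved by the up chain\<close>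

text \<open>What one row contributes to \<open>pitman\<close>: the rising factorial of
  \<open>1 - \<alpha>\<close> with \<open>p - 1\<close> factors, over \<open>p!\<close>.\<close>

definition part_weight :: "real \<Rightarrow> nat \<Rightarrow> real" where
  "part_weight \<alpha> p = (\<Prod>j\<in>{2..p}. real j - 1 - \<alpha>) / fact p"

lemma part_weight_1: "part_weight \<alpha> (Suc 0) = 1"
  by (simp add: part_weight_def)

text \<open>This exchanges the up rate \<open>k - \<alpha>\<close> for the down rate
  \<open>k + 1\<close>.\<close>

lemma part_weight_Suc:
  assumes "k \<ge> 1"
  shows "part_weight \<alpha> (Suc k) * real (Suc k) = part_weight \<alpha> k * (real k - \<alpha>)"
proof -
  have "(\<Prod>j\<in>{2..Suc k}. real j - 1 - \<alpha>) = (\<Prod>j\<in>{2..k}. real j - 1 - \<alpha>) * (real k - \<alpha>)"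
    using assms by (simp add: prod.cl_ivl_Suc)
  then show ?thesis
    by (simp add: part_weight_def del: of_nat_Suc)
qed

lemma prod_fact_count_add_mset:
  "(\<Prod>k\<in>set_mset (add_mset a l). fact (count (add_mset a l) k) :: real)
     = real (Suc (count l a)) * (\<Prod>k\<in>set_mset l. fact (count l k))"
proof -
  have "(\<Prod>k\<in>set_mset l - {a}. fact (count (add_mset a l) k)) = (\<Prod>k\<in>set_mset l - {a}. fact (count l k) :: real)"
    by (intro prod.cong) auto
  moreover have "(\<Prod>k\<in>set_mset l. fact (count l k) :: real)
      = fact (count l a) * (\<Prod>k\<in>set_mset l - {a}. fact (count l k))"
  proof (cases "a \<in># l")
    case False
    then show ?thesis by (simp add: not_in_iff)
  qed (simp add: prod.remove)
  ultimately show ?thesis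
    by (simp add: prod.insert_remove mult_ac)
qed

lemma pitman_eq_part_weight:
  "pitman \<theta> \<alpha> n l = fact n / pochhammer \<theta> n * ((\<Prod>i<size l. \<theta> + real i * \<alpha>)
     * (\<Prod>p\<in>#l. part_weight \<alpha> p) / (\<Prod>k\<in>set_mset l. fact (count l k)))"
proof -
  have "(\<Prod>p\<in>#l. part_weight \<alpha> p) = (\<Prod>p\<in>#l. \<Prod>j\<in>{2..p}. real j - 1 - \<alpha>) / (\<Prod>p\<in>#l. fact p)"
    by (induction l) (auto simp: part_weight_def)
  then show ?thesis by (simp add: pitman_def mult_ac)
qed

text \<open>The factor \<open>Suc (count w a)\<close> cancels the change in the multiplicity
  factorials, so that the right side depends on \<open>a\<close> only through
  \<open>part_weight \<alpha> a\<close>. Partitions extending the same \<open>w\<close> by different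
  parts thus become comparable.\<close>

lemma pitman_add_mset:
  "pitman \<theta> \<alpha> n (add_mset a w) * real (Suc (count w a)) = fact n / pochhammer \<theta> n
     * ((\<Prod>i<size w. \<theta> + real i * \<alpha>) * (\<theta> + real (size w) * \<alpha>) * part_weight \<alpha> a
     * (\<Prod>p\<in>#w. part_weight \<alpha> p) / (\<Prod>k\<in>set_mset w. fact (count w k)))"
  unfolding pitman_eq_part_weight prod_fact_count_add_mset
  by (simp add: mult_ac del: of_nat_Suc set_mset_add_mset_insert)

lemma pitman_pos:
  assumes "0 < \<theta>" "0 \<le> \<alpha>" "\<alpha> < 1"
  shows "0 < pitman \<theta> \<alpha> n l"
proof -
  have "0 < part_weight \<alpha> p" for p
    using assms by (auto simp: part_weight_def intro!: divide_pos_pos prod_pos)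
  then have "0 < (\<Prod>p\<in>#l. part_weight \<alpha> p)"
    by (induction l) auto
  moreover have "0 < (\<Prod>i<size l. \<theta> + real i * \<alpha>)"
    using assms by (intro prod_pos) (auto intro: add_pos_nonneg)
  moreover have "0 < (\<Prod>k\<in>set_mset l. fact (count l k) :: real)"
    by (intro prod_pos) auto
  ultimately show ?thesis
    unfolding pitman_eq_part_weight using assms
    by (intro mult_pos_pos divide_pos_pos) (auto intro: pochhammer_pos)
qed

lemma fact_pochhammer_Suc:
  assumes "0 < (\<theta> :: real)"
  shows "fact (Suc n) / pochhammer \<theta> (Suc n) / (real n + 1) = fact n / pochhammer \<theta> n / (\<theta> + real n)"
  by (simp add: pochhammer_Suc add.commute[of _ "1 :: real"])

text \<open>Detailed balance across levels for one move: the last factor on the right is the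
  probability that the down chain undoes it. Both partitions extend a common \<open>w\<close> by one
  part, so only a ratio of part weights and of normalising constants is left.\<close>

lemma pitman_add_box_balance:
  assumes "0 < \<theta>" "z \<in> partitions n" "k \<in># z"
  shows "pitman \<theta> \<alpha> n z * ((real k - \<alpha>) * real (count z k) / (\<theta> + real n))
    = pitman \<theta> \<alpha> (Suc n) (add_box k z)
      * (real (Suc k) * real (count (add_box k z) (Suc k)) / (real n + 1))"
proof -
  obtain w where w: "z = add_mset k w" using multi_member_split[OF assms(3)] by blast
  have "k \<ge> 1" using assms(2,3) by (cases k) (auto simp: partitions_def)
  \<comment> \<open>The factor shared by \<open>z\<close> and \<open>add_box k z\<close>, which both
    have \<open>size w + 1\<close> rows.\<close>
  define C where "C = (\<Prod>i<size w. \<theta> + real i * \<alpha>) * (\<theta> + real (size w) * \<alpha>)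
     * (\<Prod>p\<in>#w. part_weight \<alpha> p) / (\<Prod>k\<in>set_mset w. fact (count w k))"
  have "pitman \<theta> \<alpha> n z * real (count z k) = fact n / pochhammer \<theta> n * (part_weight \<alpha> k * C)"
    using pitman_add_mset[of \<theta> \<alpha> n k w] by (simp add: w C_def mult_ac)
  moreover have "pitman \<theta> \<alpha> n z * ((real k - \<alpha>) * real (count z k) / (\<theta> + real n))
      = pitman \<theta> \<alpha> n z * real (count z k) * ((real k - \<alpha>) / (\<theta> + real n))"
    by simp
  ultimately have "pitman \<theta> \<alpha> n z * ((real k - \<alpha>) * real (count z k) / (\<theta> + real n))
      = fact n / pochhammer \<theta> n / (\<theta> + real n) * (part_weight \<alpha> k * (real k - \<alpha>)) * C"
    by (simp add: mult_ac)
  also have "\<dots> = fact (Suc n) / pochhammer \<theta> (Suc n) / (real n + 1)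
      * (part_weight \<alpha> (Suc k) * real (Suc k)) * C"
    unfolding fact_pochhammer_Suc[OF assms(1)] part_weight_Suc[OF \<open>k \<ge> 1\<close>] ..
  also have "\<dots> = fact (Suc n) / pochhammer \<theta> (Suc n) * (part_weight \<alpha> (Suc k) * C)
      * (real (Suc k) / (real n + 1))"
    by (simp add: mult_ac)
  also have "fact (Suc n) / pochhammer \<theta> (Suc n) * (part_weight \<alpha> (Suc k) * C)
      = pitman \<theta> \<alpha> (Suc n) (add_box k z) * real (count (add_box k z) (Suc k))"
    using pitman_add_mset[of \<theta> \<alpha> "Suc n" "Suc k" w]
    by (simp add: w add_box_def C_def mult_ac)
  finally show ?thesis by (simp add: mult_ac)
qed

text \<open>The same balance for a new row: its weight is the next factor of the product over rows
  in \<open>pitman\<close>, and a row of length 1 has part weight 1.\<close>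

lemma pitman_add_part_balance:
  assumes "0 < \<theta>"
  shows "pitman \<theta> \<alpha> n z * ((\<theta> + \<alpha> * real (size z)) / (\<theta> + real n))
    = pitman \<theta> \<alpha> (Suc n) (add_mset 1 z) * (real (count (add_mset 1 z) 1) / (real n + 1))"
proof -
  define C where "C = (\<Prod>i<size z. \<theta> + real i * \<alpha>) * (\<Prod>p\<in>#z. part_weight \<alpha> p)
     / (\<Prod>k\<in>set_mset z. fact (count z k))"
  have "pitman \<theta> \<alpha> n z * ((\<theta> + \<alpha> * real (size z)) / (\<theta> + real n))
      = fact n / pochhammer \<theta> n / (\<theta> + real n) * ((\<theta> + real (size z) * \<alpha>) * C)"
    by (simp add: pitman_eq_part_weight C_def mult_ac)
  also have "\<dots> = fact (Suc n) / pochhammer \<theta> (Suc n) / (real n + 1) * ((\<theta> + real (size z) * \<alpha>) * C)"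
    unfolding fact_pochhammer_Suc[OF assms(1)] ..
  also have "\<dots> = fact (Suc n) / pochhammer \<theta> (Suc n) * ((\<theta> + real (size z) * \<alpha>) * C) / (real n + 1)"
    by simp
  also have "fact (Suc n) / pochhammer \<theta> (Suc n) * ((\<theta> + real (size z) * \<alpha>) * C)
      = pitman \<theta> \<alpha> (Suc n) (add_mset 1 z) * real (count (add_mset 1 z) 1)"
    using pitman_add_mset[of \<theta> \<alpha> "Suc n" 1 z] by (simp add: part_weight_1 C_def mult_ac)
  finally show ?thesis by simp
qed

text \<open>The up chain carries \<pi> from level \<open>n\<close> to level \<open>n + 1\<close>: by
  detailed balance the mass moving up into \<open>y\<close> is \<pi> of \<open>y\<close> times the
  total down probability out of \<open>y\<close>, which is 1.\<close>

lemma sum_pitman_up_op: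
  assumes "0 < \<theta>"
  shows "(\<Sum>z\<in>partitions n. pitman \<theta> \<alpha> n z * up_op \<theta> \<alpha> f z)
    = (\<Sum>y\<in>partitions (Suc n). pitman \<theta> \<alpha> (Suc n) y * f y)"
proof -
  \<comment> \<open>The stationary flow through \<open>y\<close> along the removal of a box from a
    row of length \<open>j\<close>, weighted by \<open>f y\<close>.\<close>
  define g where "g y j = pitman \<theta> \<alpha> (Suc n) y * (real j * real (count y j) / (real n + 1)) * f y" for y j
  have zero_notin: "0 \<notin># z" if "z \<in> partitions m" for z m
    using that by (simp add: partitions_def)
  \<comment> \<open>A new row is treated as a box added to a row of length 0.\<close>
  have add_box_0: "add_box 0 z = add_mset 1 z" if "z \<in> partitions m" for z m
    using zero_notin[OF that] by (simp add: add_box_def diff_single_trivial)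
  have "pitman \<theta> \<alpha> n z * up_op \<theta> \<alpha> f z = (\<Sum>k\<in>insert 0 (set_mset z). g (add_box k z) (Suc k))"
    if z: "z \<in> partitions n" for z
  proof -
    have "sum_mset z = n" using z by (simp add: partitions_def)
    then have "pitman \<theta> \<alpha> n z * up_op \<theta> \<alpha> f z
      = (\<Sum>k\<in>set_mset z. pitman \<theta> \<alpha> n z * ((real k - \<alpha>) * real (count z k) / (\<theta> + real n)) * f (add_box k z))
        + pitman \<theta> \<alpha> n z * ((\<theta> + \<alpha> * real (size z)) / (\<theta> + real n)) * f (add_mset 1 z)"
      by (simp add: up_op_def sum_mset_image_eq_sum_count sum_distrib_left sum_divide_distrib
          add_divide_distrib distrib_left distrib_right mult_ac)
    also have "\<dots> = (\<Sum>k\<in>set_mset z. g (add_box k z) (Suc k)) + g (add_mset 1 z) 1"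
      unfolding g_def pitman_add_part_balance[OF assms]
      by (intro arg_cong2[of _ _ _ _ "(+)"] sum.cong) (simp_all only: pitman_add_box_balance[OF assms z] mult_1 of_nat_1)
    also have "\<dots> = (\<Sum>k\<in>insert 0 (set_mset z). g (add_box k z) (Suc k))"
      using zero_notin[OF z] add_box_0[OF z] by simp
    finally show ?thesis .
  qed
  then have "(\<Sum>z\<in>partitions n. pitman \<theta> \<alpha> n z * up_op \<theta> \<alpha> f z)
      = (\<Sum>z\<in>partitions n. \<Sum>k\<in>insert 0 (set_mset z). g (add_box k z) (Suc k))"
    by simp
  also have "\<dots> = (\<Sum>(z, k)\<in>(SIGMA z:partitions n. insert 0 (set_mset z)). g (add_box k z) (Suc k))"
    by (subst sum.Sigma) (auto simp: finite_partitions)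
  also have "\<dots> = (\<Sum>(y, j)\<in>(SIGMA y:partitions (Suc n). set_mset y). g y j)"
  \<comment> \<open>Adding to a row of length \<open>k\<close> is reversed by removing from a row of
    length \<open>k + 1\<close>; the value \<open>j - 1 = 0\<close> marks the rows that were newly
    created.\<close>
  proof (rule sum.reindex_bij_witness[where i = "\<lambda>(y, j). (remove_box j y, j - 1)"
        and j = "\<lambda>(z, k). (add_box k z, Suc k)"])
    fix a assume "a \<in> (SIGMA z:partitions n. insert 0 (set_mset z))"
    then obtain z k where a: "a = (z, k)" and z: "z \<in> partitions n" and k: "k = 0 \<or> k \<in># z"
      by auto
    have "add_box k z \<in> partitions (Suc n) \<and> Suc k \<in># add_box k z \<and> remove_box (Suc k) (add_box k z) = z"
    proof (cases "k = 0")
      case True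
      then show ?thesis
        using add_mset_1_partitions[OF z] add_box_0[OF z] by (simp add: remove_box_def)
    next
      case False
      then obtain w where "z = add_mset k w" using k multi_member_split by metis
      then show ?thesis
        using False k add_box_partitions[OF z, of k] by (simp add: add_box_def remove_box_def)
    qed
    then show "(case case a of (z, k) \<Rightarrow> (add_box k z, Suc k) of (y, j) \<Rightarrow> (remove_box j y, j - 1)) = a"
      "(case a of (z, k) \<Rightarrow> (add_box k z, Suc k)) \<in> (SIGMA y:partitions (Suc n). set_mset y)"
      "(case case a of (z, k) \<Rightarrow> (add_box k z, Suc k) of (y, j) \<Rightarrow> g y j)
        = (case a of (z, k) \<Rightarrow> g (add_box k z) (Suc k))"
      by (auto simp: a)
  next
    fix b assume "b \<in> (SIGMA y:partitions (Suc n). set_mset y)"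
    then obtain y j where b: "b = (y, j)" and y: "y \<in> partitions (Suc n)" and j: "j \<in># y"
      by auto
    obtain w where w: "y = add_mset j w" using multi_member_split[OF j] by blast
    have "0 \<notin># w" "j \<noteq> 0" using zero_notin[OF y] by (auto simp: w)
    then have "add_box (j - 1) (remove_box j y) = y" "j - 1 = 0 \<or> j - 1 \<in># remove_box j y"
      by (auto simp: w add_box_def remove_box_def diff_single_trivial)
    moreover have "remove_box j y \<in> partitions n"
      using remove_box_partitions[OF y j] by simp
    ultimately show "(case case b of (y, j) \<Rightarrow> (remove_box j y, j - 1) of (z, k) \<Rightarrow> (add_box k z, Suc k)) = b"
      "(case b of (y, j) \<Rightarrow> (remove_box j y, j - 1)) \<in> (SIGMA z:partitions n. insert 0 (set_mset z))"
      using \<open>j \<noteq> 0\<close> by (auto simp: b)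
  qed
  also have "\<dots> = (\<Sum>y\<in>partitions (Suc n). \<Sum>j\<in>set_mset y. g y j)"
    by (subst sum.Sigma) (auto simp: finite_partitions)
  also have "\<dots> = (\<Sum>y\<in>partitions (Suc n). pitman \<theta> \<alpha> (Suc n) y * f y)"
  proof (rule sum.cong[OF refl])
    fix y assume "y \<in> partitions (Suc n)"
    \<comment> \<open>Row lengths add up to the level, so the down probabilities out of
      \<open>y\<close> sum to 1.\<close>
    then have "(\<Sum>j\<in>#y. real j) = real n + 1" by (simp add: partitions_def flip: of_nat_sum_mset)
    then have "(\<Sum>j\<in>set_mset y. real j * real (count y j)) = real n + 1"
      by (simp add: sum_mset_image_eq_sum_count mult_ac del: of_nat_sum_mset)
    moreover have "(\<Sum>j\<in>set_mset y. g y j)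
        = pitman \<theta> \<alpha> (Suc n) y * ((\<Sum>j\<in>set_mset y. real j * real (count y j)) / (real n + 1)) * f y"
      by (simp add: g_def sum_distrib_left sum_distrib_right sum_divide_distrib)
    ultimately show "(\<Sum>j\<in>set_mset y. g y j) = pitman \<theta> \<alpha> (Suc n) y * f y"
      by (simp add: add_nonneg_eq_0_iff)
  qed
  finally show ?thesis .
qed

section \<open>Passing through the one-box level\<close>

lemma partitions_1: "partitions 1 = {{#1#}}"
proof -
  have "l = {#1#}" if "0 \<notin># l" "sum_mset l = 1" for l :: "nat multiset"
  proof (cases l)
    case (add a w)
    have "a + sum_mset w = 1" "a \<noteq> 0" "0 \<notin># w" using that by (auto simp: add)
    then have "a = 1" "size w = 0" using size_mset_le_sum_mset[of w] by linarith+
    then have "w = {#}" by simp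
    then show ?thesis using \<open>a = 1\<close> add by simp
  qed (use that in simp)
  then show ?thesis by (auto simp: partitions_def)
qed

text \<open>On level 1 the Pitman distribution is a point mass, and each up step carries it to the
  next level. The innermost \<open>up_op\<close> is peeled off, hence \<open>f\<close> varies in the
  induction.\<close>

lemma funpow_up_op_1:
  assumes "0 < \<theta>"
  shows "(up_op \<theta> \<alpha> ^^ m) f {#1#} = (\<Sum>y\<in>partitions (Suc m). pitman \<theta> \<alpha> (Suc m) y * f y)"
proof (induction m arbitrary: f)
  case 0
  have "pitman \<theta> \<alpha> 1 {#1#} = 1"
    using assms by (simp add: pitman_def)
  then show ?case by (simp add: partitions_1[unfolded One_nat_def])
next
  case (Suc m)
  have "(up_op \<theta> \<alpha> ^^ Suc m) f {#1#} = (up_op \<theta> \<alpha> ^^ m) (up_op \<theta> \<alpha> f) {#1#}"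
    by (simp only: funpow_Suc_right o_apply)
  also have "\<dots> = (\<Sum>z\<in>partitions (Suc m). pitman \<theta> \<alpha> (Suc m) z * up_op \<theta> \<alpha> f z)"
    by (rule Suc)
  also have "\<dots> = (\<Sum>y\<in>partitions (Suc (Suc m)). pitman \<theta> \<alpha> (Suc (Suc m)) y * f y)"
    by (rule sum_pitman_up_op[OF assms])
  finally show ?case .
qed

lemma down_op_const: "l \<in> partitions (Suc n) \<Longrightarrow> down_op (\<lambda>_. c) l = c"
proof -
  assume "l \<in> partitions (Suc n)"
  then have "real (sum_mset l) \<noteq> 0" by (simp add: partitions_def del: of_nat_sum_mset)
  moreover have "(\<Sum>j\<in>#l. real j * c) = real (sum_mset l) * c"
    by (induction l) (auto simp: algebra_simps)
  ultimately show ?thesis by (simp add: down_op_def del: of_nat_sum_mset)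
qed

text \<open>The total deficit \<open>\<alpha> * size l\<close> of the existing rows is made up by
  the weight of a new row.\<close>

lemma up_op_const: "0 < \<theta> \<Longrightarrow> up_op \<theta> \<alpha> (\<lambda>_. c) l = c"
proof -
  assume "0 < \<theta>"
  then have "\<theta> + real (sum_mset l) \<noteq> 0" by (simp add: add_nonneg_eq_0_iff del: of_nat_sum_mset)
  moreover have "(\<Sum>k\<in>#l. (real k - \<alpha>) * c) = (real (sum_mset l) - \<alpha> * real (size l)) * c"
    by (induction l) (auto simp: algebra_simps)
  ultimately show ?thesis by (simp add: up_op_def field_simps del: of_nat_sum_mset)
qed

text \<open>Every partition of \<open>m + 1\<close> shrinks to the unique partition of 1, so the
  starting state is forgotten.\<close>

lemma funpow_down_op_1:
  assumes "x \<in> partitions (Suc m)"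
  shows "(down_op ^^ m) h x = h {#1#}"
  using assms
proof (induction m arbitrary: x)
  case 0
  then show ?case by (simp add: partitions_1[unfolded One_nat_def])
next
  case (Suc m)
  have "(down_op ^^ Suc m) h x = down_op (\<lambda>_. h {#1#}) x"
    unfolding funpow.simps o_apply by (rule down_op_cong[OF Suc.prems]) (simp add: Suc.IH)
  also have "\<dots> = h {#1#}" by (rule down_op_const[OF Suc.prems])
  finally show ?case .
qed

section \<open>Powers of the down-up walk\<close>

lemma funpow_down_op_linear:
  "(down_op ^^ k) (\<lambda>l. a * f l + b * g l) = (\<lambda>l. a * (down_op ^^ k) f l + b * (down_op ^^ k) g l)"
  by (induction k) (simp_all add: ext[OF down_op_linear])

text \<open>\<open>U\<close> is moved past one \<open>D\<close> at a time, with the induction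
  hypothesis used one level lower. Since \<open>\<theta> + 2 * real n\<close> is the difference of
  \<open>(i + 1) * (\<theta> + i)\<close> and \<open>i * (\<theta> + i - 1)\<close> at
  \<open>i = n\<close>, the coefficients telescope. For \<open>k = 0\<close> the last coefficient
  vanishes, so the truncated \<open>k - 1\<close> is harmless.\<close>

lemma up_op_funpow_down_op:
  assumes "l \<in> partitions n" "k \<le> n" "0 < \<theta>"
  shows "(real n + 1) * (\<theta> + real n) * up_op \<theta> \<alpha> ((down_op ^^ k) h) l
    = (real n + 1 - real k) * (\<theta> + real n - real k) * (down_op ^^ k) (up_op \<theta> \<alpha> h) l
      + ((real n + 1) * (\<theta> + real n) - (real n + 1 - real k) * (\<theta> + real n - real k))
        * (down_op ^^ (k - 1)) h l"
  using assms(1,2)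
proof (induction k arbitrary: l n)
  case (Suc k)
  \<comment> \<open>The coefficients of the induction hypothesis at level
    \<open>n - 1\<close>.\<close>
  define c where "c = (real n - real k) * (\<theta> + real n - 1 - real k)"
  define d where "d = real n * (\<theta> + real n - 1)"
  have n: "n \<ge> 1" using Suc.prems by simp
  have d: "d \<noteq> 0" using n assms(3) by (simp add: d_def)
  have IH: "up_op \<theta> \<alpha> ((down_op ^^ k) h) z
      = c / d * (down_op ^^ k) (up_op \<theta> \<alpha> h) z + (1 - c / d) * (down_op ^^ (k - 1)) h z"
    if z: "z \<in> partitions (n - 1)" for z
  proof -
    have "real (n - 1) = real n - 1" using n by (simp add: of_nat_diff)
    then have "d * up_op \<theta> \<alpha> ((down_op ^^ k) h) z
        = c * (down_op ^^ k) (up_op \<theta> \<alpha> h) z + (d - c) * (down_op ^^ (k - 1)) h z"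
      using Suc.IH[OF z] Suc.prems(2) by (simp add: c_def d_def algebra_simps)
    then show ?thesis using d by (simp add: field_simps)
  qed
  have "down_op (up_op \<theta> \<alpha> ((down_op ^^ k) h)) l
      = c / d * down_op ((down_op ^^ k) (up_op \<theta> \<alpha> h)) l
        + (1 - c / d) * down_op ((down_op ^^ (k - 1)) h) l"
    by (subst down_op_linear[symmetric]) (rule down_op_cong[OF Suc.prems(1) IH])
  \<comment> \<open>For \<open>k = 0\<close> truncation makes \<open>Suc (k - 1)\<close> differ from
    \<open>k\<close>, but then \<open>c = d\<close> and both sides are 0.\<close>
  moreover have "(1 - c / d) * down_op ((down_op ^^ (k - 1)) h) l = (1 - c / d) * (down_op ^^ k) h l"
    using d by (cases k) (simp_all add: c_def d_def)
  ultimately have "d * down_op (up_op \<theta> \<alpha> ((down_op ^^ k) h)) l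
      = c * (down_op ^^ Suc k) (up_op \<theta> \<alpha> h) l + (d - c) * (down_op ^^ k) h l"
    using d by (simp add: field_simps)
  moreover have "(real n + 1) * (\<theta> + real n) * up_op \<theta> \<alpha> ((down_op ^^ Suc k) h) l
      = d * down_op (up_op \<theta> \<alpha> ((down_op ^^ k) h)) l + (\<theta> + 2 * real n) * (down_op ^^ k) h l"
    using up_op_down_op[OF Suc.prems(1) n assms(3)] by (simp add: d_def)
  ultimately show ?case
    by (simp add: c_def d_def algebra_simps)
qed simp

section \<open>The walk operator and its action on \<open>B\<^sub>k\<close>\<close>

definition walk_op :: "real \<Rightarrow> real \<Rightarrow> (nat multiset \<Rightarrow> real) \<Rightarrow> nat multiset \<Rightarrow> real" where
  "walk_op \<theta> \<alpha> f = down_op (up_op \<theta> \<alpha> f)"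

lemma walk_op_linear: "walk_op \<theta> \<alpha> (\<lambda>l. a * f l + b * g l) l = a * walk_op \<theta> \<alpha> f l + b * walk_op \<theta> \<alpha> g l"
  by (simp add: walk_op_def down_op_linear ext[OF up_op_linear])

lemma funpow_walk_op_linear:
  "(walk_op \<theta> \<alpha> ^^ r) (\<lambda>l. a * f l + b * g l)
     = (\<lambda>l. a * (walk_op \<theta> \<alpha> ^^ r) f l + b * (walk_op \<theta> \<alpha> ^^ r) g l)"
  by (induction r) (simp_all add: ext[OF walk_op_linear])

lemma walk_op_cong:
  assumes "l \<in> partitions n" "n \<ge> 1" "\<And>z. z \<in> partitions n \<Longrightarrow> f z = g z"
  shows "walk_op \<theta> \<alpha> f l = walk_op \<theta> \<alpha> g l"
  unfolding walk_op_def using assms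
  by (intro down_op_cong[OF assms(1)] up_op_cong[where n = "n - 1"]) auto

lemma funpow_walk_op_cong:
  assumes "l \<in> partitions n" "n \<ge> 1" "\<And>z. z \<in> partitions n \<Longrightarrow> f z = g z"
  shows "(walk_op \<theta> \<alpha> ^^ r) f l = (walk_op \<theta> \<alpha> ^^ r) g l"
  using assms(1)
proof (induction r arbitrary: l)
  case (Suc r)
  then show ?case
    by (simp add: walk_op_cong[OF Suc.prems assms(2) Suc.IH])
qed (use assms(3) in simp)

lemma sum_down_up_walk:
  assumes "x \<in> partitions n" "n \<ge> 1"
  shows "(\<Sum>z\<in>partitions n. down_up_walk \<theta> \<alpha> n x z * g z) = walk_op \<theta> \<alpha> g x"
proof -
  have "(\<Sum>z\<in>partitions n. down_up_walk \<theta> \<alpha> n x z * g z)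
      = (\<Sum>k\<in>partitions (n - 1). down_prob n x k * (\<Sum>z\<in>partitions n. up_prob \<theta> \<alpha> (n - 1) k z * g z))"
    unfolding down_up_walk_def sum_distrib_left sum_distrib_right
    by (subst sum.swap) (simp add: mult_ac)
  also have "\<dots> = (\<Sum>k\<in>partitions (n - 1). down_prob n x k * up_op \<theta> \<alpha> g k)"
    using sum_up_prob[of _ "n - 1" \<theta> \<alpha> g] assms(2) by simp
  also have "\<dots> = walk_op \<theta> \<alpha> g x"
    unfolding walk_op_def by (rule sum_down_prob[OF assms(1)])
  finally show ?thesis .
qed

text \<open>The first-step recursion of \<open>kernel_power\<close> is one outer application of
  \<open>walk_op\<close>, starting from the indicator of \<open>y\<close>.\<close>

lemma kernel_power_down_up_walk:
  assumes "x \<in> partitions n" "n \<ge> 1"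
  shows "kernel_power (partitions n) (down_up_walk \<theta> \<alpha> n) r x y
    = (walk_op \<theta> \<alpha> ^^ r) (\<lambda>z. if z = y then 1 else 0) x"
  using assms(1)
proof (induction r arbitrary: x)
  case (Suc r)
  have "kernel_power (partitions n) (down_up_walk \<theta> \<alpha> n) (Suc r) x y
      = (\<Sum>z\<in>partitions n. down_up_walk \<theta> \<alpha> n x z * (walk_op \<theta> \<alpha> ^^ r) (\<lambda>z. if z = y then 1 else 0) z)"
    by (simp add: Suc.IH)
  also have "\<dots> = (walk_op \<theta> \<alpha> ^^ Suc r) (\<lambda>z. if z = y then 1 else 0) x"
    by (simp add: sum_down_up_walk[OF Suc.prems assms(2)])
  finally show ?case .
qed simp

text \<open>The operator \<open>B\<^sub>k\<close> of the overview; \<open>k = 0\<close> is the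
  identity.\<close>

definition down_up_op :: "real \<Rightarrow> real \<Rightarrow> nat \<Rightarrow> (nat multiset \<Rightarrow> real) \<Rightarrow> nat multiset \<Rightarrow> real" where
  "down_up_op \<theta> \<alpha> k f = (down_op ^^ k) ((up_op \<theta> \<alpha> ^^ k) f)"

definition step_prob :: "real \<Rightarrow> nat \<Rightarrow> nat \<Rightarrow> real" where
  "step_prob \<theta> n i = real i * (\<theta> + real i - 1) / (real n * (\<theta> + real n - 1))"

lemma step_prob_bounds:
  assumes "0 < \<theta>" "1 \<le> i" "i \<le> n"
  shows "0 < step_prob \<theta> n i" "step_prob \<theta> n i \<le> 1"
proof -
  have "0 < real i * (\<theta> + real i - 1)" using assms by (intro mult_pos_pos) auto
  moreover have "real i * (\<theta> + real i - 1) \<le> real n * (\<theta> + real n - 1)"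
    using assms by (intro mult_mono) auto
  ultimately show "0 < step_prob \<theta> n i" "step_prob \<theta> n i \<le> 1"
    by (auto simp: step_prob_def)
qed

text \<open>In \<open>D U D\<^sup>k U\<^sup>k\<close> the inner \<open>U\<close> is moved past
  \<open>D\<^sup>k\<close> by the commutation rule at level \<open>n - 1\<close>. For
  \<open>k = 0\<close> the parameter is 1 and the identity reads
  \<open>K = B\<^sub>1\<close>.\<close>

lemma walk_op_down_up_op:
  assumes "l \<in> partitions n" "k < n" "0 < \<theta>"
  shows "walk_op \<theta> \<alpha> (down_up_op \<theta> \<alpha> k f) l
    = step_prob \<theta> n (n - k) * down_up_op \<theta> \<alpha> (Suc k) f l
      + (1 - step_prob \<theta> n (n - k)) * down_up_op \<theta> \<alpha> k f l"
proof -
  define p where "p = step_prob \<theta> n (n - k)"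
  define h where "h = (up_op \<theta> \<alpha> ^^ k) f"
  define c where "c = (real n - real k) * (\<theta> + real n - 1 - real k)"
  define d where "d = real n * (\<theta> + real n - 1)"
  have d: "d \<noteq> 0" using assms by (simp add: d_def)
  have p: "p = c / d" using assms(2) by (simp add: p_def c_def d_def step_prob_def of_nat_diff algebra_simps)
  have "up_op \<theta> \<alpha> ((down_op ^^ k) h) z
      = p * (down_op ^^ k) (up_op \<theta> \<alpha> h) z + (1 - p) * (down_op ^^ (k - 1)) h z"
    if z: "z \<in> partitions (n - 1)" for z
  proof -
    have "real (n - 1) = real n - 1" using assms(2) by (simp add: of_nat_diff)
    then have "d * up_op \<theta> \<alpha> ((down_op ^^ k) h) z
        = c * (down_op ^^ k) (up_op \<theta> \<alpha> h) z + (d - c) * (down_op ^^ (k - 1)) h z"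
      using up_op_funpow_down_op[OF z, of k \<theta> \<alpha> h] assms(2,3) by (simp add: c_def d_def algebra_simps)
    then show ?thesis using d by (simp add: p field_simps)
  qed
  then have "walk_op \<theta> \<alpha> (down_up_op \<theta> \<alpha> k f) l
      = p * down_op ((down_op ^^ k) (up_op \<theta> \<alpha> h)) l + (1 - p) * down_op ((down_op ^^ (k - 1)) h) l"
    unfolding walk_op_def down_up_op_def h_def[symmetric]
    by (subst down_op_linear[symmetric]) (rule down_op_cong[OF assms(1)])
  moreover have "(1 - p) * down_op ((down_op ^^ (k - 1)) h) l = (1 - p) * (down_op ^^ k) h l"
    using d by (cases k) (simp_all add: p c_def d_def)
  ultimately show ?thesis
    by (simp add: p_def h_def down_up_op_def)
qed

lemma funpow_walk_op_const:
  assumes "x \<in> partitions n" "n \<ge> 1" "0 < \<theta>"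
  shows "(walk_op \<theta> \<alpha> ^^ r) (\<lambda>_. c) x = c"
  using assms(1)
proof (induction r arbitrary: x)
  case (Suc r)
  have "(walk_op \<theta> \<alpha> ^^ Suc r) (\<lambda>_. c) x = walk_op \<theta> \<alpha> (\<lambda>_. c) x"
    unfolding funpow.simps o_apply by (rule walk_op_cong[OF Suc.prems assms(2) Suc.IH])
  also have "\<dots> = c"
    using down_op_const[of x "n - 1"] Suc.prems assms(2,3) by (simp add: walk_op_def ext[OF up_op_const])
  finally show ?case .
qed simp

text \<open>All \<open>m\<close> down steps end in the single box, from which \<open>m\<close> up
  steps produce \<pi>.\<close>

lemma down_up_op_eq_pitman:
  assumes "x \<in> partitions (Suc m)" "0 < \<theta>"
  shows "down_up_op \<theta> \<alpha> m f x = (\<Sum>y\<in>partitions (Suc m). pitman \<theta> \<alpha> (Suc m) y * f y)"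
  by (simp only: down_up_op_def funpow_down_op_1[OF assms(1)] funpow_up_op_1[OF assms(2)])

lemma down_up_op_nonneg:
  assumes "0 < \<theta>" "0 \<le> \<alpha>" "\<alpha> < 1" "0 \<notin># x" "\<And>z. 0 \<le> f z"
  shows "0 \<le> down_up_op \<theta> \<alpha> k f x"
proof -
  have up: "0 \<le> (up_op \<theta> \<alpha> ^^ j) f z" if "0 \<notin># z" for j z
    using that by (induction j arbitrary: z) (auto simp: assms intro!: up_op_nonneg)
  have "0 \<le> (down_op ^^ j) ((up_op \<theta> \<alpha> ^^ k) f) z" if "0 \<notin># z" for j z
    using that by (induction j arbitrary: z) (auto simp: up intro!: down_op_nonneg)
  then show ?thesis by (simp add: down_up_op_def assms(4))
qed

text \<open>Up moves never shorten a row, so a row of length at least 2 persists and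
  \<open>f\<close> is only evaluated where it vanishes.\<close>

lemma funpow_up_op_eq_0:
  assumes "\<And>z. \<exists>p\<in>#z. 2 \<le> p \<Longrightarrow> f z = 0" "\<exists>p\<in>#l. 2 \<le> p"
  shows "(up_op \<theta> \<alpha> ^^ k) f l = 0"
  using assms(2)
proof (induction k arbitrary: l)
  case (Suc k)
  have "\<exists>p\<in>#add_box j l. 2 \<le> p" if "j \<in># l" for j
  proof -
    obtain p where p: "p \<in># l" "2 \<le> p" using Suc.prems by blast
    show ?thesis
    proof (cases "p = j")
      case True
      then show ?thesis using p by (intro bexI[of _ "j + 1"]) (auto simp: add_box_def)
    next
      case False
      then show ?thesis using p by (intro bexI[of _ p]) (auto simp: add_box_def in_diff_count)
    qed
  qed
  moreover have "\<exists>p\<in>#add_mset 1 l. 2 \<le> p" using Suc.prems by auto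
  ultimately show ?case by (simp add: up_op_def[of _ _ "(up_op \<theta> \<alpha> ^^ k) f"] Suc.IH sum_mset_image_eq_sum_count)
qed (use assms(1) in simp)

lemma funpow_down_op_single: "k < n \<Longrightarrow> (down_op ^^ k) h {#n#} = h {#n - k#}"
proof (induction k arbitrary: n)
  case (Suc k)
  then have "(down_op ^^ Suc k) h {#n#} = (down_op ^^ k) h {#n - 1#}"
    by (simp add: down_op_def remove_box_def)
  then show ?case using Suc by simp
qed simp

text \<open>A single row stays single while shrinking; \<open>k + 2 \<le> n\<close> leaves it at
  length at least 2 when the up steps begin.\<close>

lemma down_up_op_single_eq_0:
  assumes "k + 2 \<le> n" "\<And>z. \<exists>p\<in>#z. 2 \<le> p \<Longrightarrow> f z = 0"
  shows "down_up_op \<theta> \<alpha> k f {#n#} = 0"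
  using assms(1) by (simp add: down_up_op_def funpow_down_op_single funpow_up_op_eq_0[OF assms(2)])

text \<open>The two instances of \<open>P\<close> are \<open>0 \<le> a\<close>, for the upper bound on the separation, and \<open>a = 0\<close>,
  for the pair of states attaining it.\<close>

lemma funpow_walk_op_down_up_op:
  fixes F :: "nat \<Rightarrow> nat \<Rightarrow> real" and P :: "real \<Rightarrow> bool"
  assumes "x \<in> partitions n" "0 < \<theta>"
    and F_1: "\<And>r. F 1 r = 1" and F_0: "\<And>i. 2 \<le> i \<Longrightarrow> i \<le> n \<Longrightarrow> F i 0 = 0"
    and F_Suc: "\<And>i r. 2 \<le> i \<Longrightarrow> i \<le> n \<Longrightarrow>
      F i (Suc r) = step_prob \<theta> n i * F (i - 1) r + (1 - step_prob \<theta> n i) * F i r"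
    and P_0: "P 0" and P_f: "\<And>k. k + 2 \<le> n \<Longrightarrow> P (down_up_op \<theta> \<alpha> k f x)"
    and P_convex: "\<And>a b p. 0 \<le> p \<Longrightarrow> p \<le> 1 \<Longrightarrow> P a \<Longrightarrow> P b \<Longrightarrow> P (p * a + (1 - p) * b)"
    and "k < n"
  shows "P ((walk_op \<theta> \<alpha> ^^ r) (down_up_op \<theta> \<alpha> k f) x
    - F (n - k) r * (\<Sum>y\<in>partitions n. pitman \<theta> \<alpha> n y * f y))"
  using \<open>k < n\<close>
proof (induction r arbitrary: k)
  case 0
  show ?case
  proof (cases "k + 2 \<le> n")
    case True
    then show ?thesis using P_f by (simp add: F_0)
  next
    case False
    \<comment> \<open>Here \<open>B\<^sub>k\<close> already averages against \<pi> and
      \<open>F 1 0 = 1\<close>, so the difference is 0.\<close>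
    then have n: "n = Suc k" using 0 by simp
    show ?thesis
      using down_up_op_eq_pitman[of x k \<theta>] assms(1,2) F_1 P_0 by (simp add: n)
  qed
next
  case (Suc r)
  define S where "S = (\<Sum>y\<in>partitions n. pitman \<theta> \<alpha> n y * f y)"
  have n: "n \<ge> 1" using Suc.prems by simp
  show ?case
  proof (cases "k + 2 \<le> n")
    case True
    \<comment> \<open>The step of the walk next to \<open>B\<^sub>k\<close> splits it into
      \<open>B\<^sub>k\<^sub>+\<^sub>1\<close> and \<open>B\<^sub>k\<close>. As \<open>F\<close>
      obeys the same recursion, the difference is a convex combination of the two differences in the
      induction hypothesis.\<close>
    define p where "p = step_prob \<theta> n (n - k)"
    have "(walk_op \<theta> \<alpha> ^^ Suc r) (down_up_op \<theta> \<alpha> k f) x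
        = (walk_op \<theta> \<alpha> ^^ r) (walk_op \<theta> \<alpha> (down_up_op \<theta> \<alpha> k f)) x"
      by (simp only: funpow_Suc_right o_apply)
    also have "\<dots> = (walk_op \<theta> \<alpha> ^^ r)
        (\<lambda>z. p * down_up_op \<theta> \<alpha> (Suc k) f z + (1 - p) * down_up_op \<theta> \<alpha> k f z) x"
      unfolding p_def
      by (intro funpow_walk_op_cong[OF assms(1) n] walk_op_down_up_op Suc.prems assms(2))
    finally have "(walk_op \<theta> \<alpha> ^^ Suc r) (down_up_op \<theta> \<alpha> k f) x = p * (walk_op \<theta> \<alpha> ^^ r) (down_up_op \<theta> \<alpha> (Suc k) f) x
        + (1 - p) * (walk_op \<theta> \<alpha> ^^ r) (down_up_op \<theta> \<alpha> k f) x"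
      by (simp add: funpow_walk_op_linear)
    moreover have "F (n - k) (Suc r) = p * F (n - Suc k) r + (1 - p) * F (n - k) r"
      using F_Suc[of "n - k" r] True by (simp add: p_def)
    ultimately have "(walk_op \<theta> \<alpha> ^^ Suc r) (down_up_op \<theta> \<alpha> k f) x - F (n - k) (Suc r) * S
        = p * ((walk_op \<theta> \<alpha> ^^ r) (down_up_op \<theta> \<alpha> (Suc k) f) x - F (n - Suc k) r * S)
          + (1 - p) * ((walk_op \<theta> \<alpha> ^^ r) (down_up_op \<theta> \<alpha> k f) x - F (n - k) r * S)"
      by (simp only:) (simp add: algebra_simps)
    moreover have "1 \<le> n - k" "n - k \<le> n" using True by simp_all
    then have "0 \<le> p" "p \<le> 1"
      using step_prob_bounds[OF assms(2), of "n - k" n] by (simp_all add: p_def less_imp_le)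
    ultimately show ?thesis
      using P_convex Suc.IH[of k] Suc.IH[of "Suc k"] True by (simp add: S_def)
  next
    case False
    \<comment> \<open>Now \<open>B\<^sub>k f\<close> is the constant \<open>S\<close> on level
      \<open>n\<close>, and the walk fixes constants.\<close>
    then have k: "n = Suc k" using Suc.prems by simp
    have "(walk_op \<theta> \<alpha> ^^ Suc r) (down_up_op \<theta> \<alpha> k f) x = (walk_op \<theta> \<alpha> ^^ Suc r) (\<lambda>_. S) x"
      using down_up_op_eq_pitman assms(2)
      by (intro funpow_walk_op_cong[OF assms(1) n]) (simp add: S_def k)
    also have "\<dots> = S" by (rule funpow_walk_op_const[OF assms(1) n assms(2)])
    finally show ?thesis using P_0 F_1 by (simp add: S_def k)
  qed
qed

text \<open>\<open>F (n - k) r\<close> is the weight of \<pi> in \<open>K\<^sup>r B\<^sub>k\<close>.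
  Probability enters only through the recursion of \<open>F\<close>, later met by the distribution
  functions of partial sums of geometric variables.\<close>

lemma max_separation_down_up_walk:
  fixes F :: "nat \<Rightarrow> nat \<Rightarrow> real"
  assumes \<theta>: "0 < \<theta>" and \<alpha>: "0 \<le> \<alpha>" "\<alpha> < 1" and n: "1 \<le> n"
    and F: "\<And>r. F 1 r = 1" "\<And>i. 2 \<le> i \<Longrightarrow> i \<le> n \<Longrightarrow> F i 0 = 0"
      "\<And>i r. 2 \<le> i \<Longrightarrow> i \<le> n \<Longrightarrow>
        F i (Suc r) = step_prob \<theta> n i * F (i - 1) r + (1 - step_prob \<theta> n i) * F i r"
  shows "max_separation (partitions n) (down_up_walk \<theta> \<alpha> n) (pitman \<theta> \<alpha> n) r = 1 - F n r"
  unfolding max_separation_def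
proof (rule Max_eqI)
  let ?\<delta> = "\<lambda>y z :: nat multiset. if z = y then 1 else 0 :: real"
  let ?s = "\<lambda>x y. 1 - kernel_power (partitions n) (down_up_walk \<theta> \<alpha> n) r x y / pitman \<theta> \<alpha> n y"
  have "{?s x y |x y. x \<in> partitions n \<and> y \<in> partitions n}
      = (\<lambda>(x, y). ?s x y) ` (partitions n \<times> partitions n)" by auto
  then show "finite {?s x y |x y. x \<in> partitions n \<and> y \<in> partitions n}"
    by (simp add: finite_partitions)
  have pos: "0 < pitman \<theta> \<alpha> n y" for y
    by (rule pitman_pos[OF \<theta> \<alpha>])
  have sum_pitman: "(\<Sum>z\<in>partitions n. pitman \<theta> \<alpha> n z * ?\<delta> y z) = pitman \<theta> \<alpha> n y"
    if "y \<in> partitions n" for y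
    using that by (simp add: finite_partitions if_distrib[of "\<lambda>u. pitman \<theta> \<alpha> n _ * u"] cong: if_cong)
  have power: "kernel_power (partitions n) (down_up_walk \<theta> \<alpha> n) r x y
      = (walk_op \<theta> \<alpha> ^^ r) (down_up_op \<theta> \<alpha> 0 (?\<delta> y)) x" if "x \<in> partitions n" for x y
    using kernel_power_down_up_walk[OF that n] by (simp add: down_up_op_def)
  {
    fix t assume "t \<in> {?s x y |x y. x \<in> partitions n \<and> y \<in> partitions n}"
    then obtain x y where t: "t = ?s x y" and x: "x \<in> partitions n" and y: "y \<in> partitions n"
      by blast
    have "0 \<notin># x" using x by (simp add: partitions_def)
    have "0 \<le> (walk_op \<theta> \<alpha> ^^ r) (down_up_op \<theta> \<alpha> 0 (?\<delta> y)) x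
        - F (n - 0) r * (\<Sum>z\<in>partitions n. pitman \<theta> \<alpha> n z * ?\<delta> y z)"
      by (rule funpow_walk_op_down_up_op[where P = "\<lambda>a. 0 \<le> a", OF x \<theta> F])
        (use n in \<open>auto intro: down_up_op_nonneg[OF \<theta> \<alpha> \<open>0 \<notin># x\<close>]\<close>)
    then have "F n r * pitman \<theta> \<alpha> n y \<le> kernel_power (partitions n) (down_up_walk \<theta> \<alpha> n) r x y"
      using power[OF x] sum_pitman[OF y] by simp
    then show "t \<le> 1 - F n r"
      using pos by (simp add: t pos_le_divide_eq)
  }
  \<comment> \<open>The one-column partition: its indicator vanishes on every partition with a row
    of length at least 2, so from \<open>{#n#}\<close> all terms other than the \<pi> term are
    0.\<close>
  define y where "y = replicate_mset n (1 :: nat)"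
  have x: "{#n#} \<in> partitions n" and y: "y \<in> partitions n"
    using n by (auto simp: partitions_def y_def)
  have "?\<delta> y z = 0" if "\<exists>p\<in>#z. 2 \<le> p" for z
    using that by (auto simp: y_def split: if_splits)
  then have "(walk_op \<theta> \<alpha> ^^ r) (down_up_op \<theta> \<alpha> 0 (?\<delta> y)) {#n#}
      - F (n - 0) r * (\<Sum>z\<in>partitions n. pitman \<theta> \<alpha> n z * ?\<delta> y z) = 0"
    using n by (intro funpow_walk_op_down_up_op[where P = "\<lambda>a. a = 0", OF x \<theta> F] down_up_op_single_eq_0) auto
  then have "kernel_power (partitions n) (down_up_walk \<theta> \<alpha> n) r {#n#} y = F n r * pitman \<theta> \<alpha> n y"
    using power[OF x] sum_pitman[OF y] by simp
  then have "?s {#n#} y = 1 - F n r"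
    using pos[of y] by simp
  then show "1 - F n r \<in> {?s x y |x y. x \<in> partitions n \<and> y \<in> partitions n}"
    using x y by (intro CollectI exI[of _ "{#n#}"] exI[of _ y]) simp
qed

section \<open>Sums of independent geometric variables\<close>

context prob_space
begin

text \<open>\<open>geometric_rv\<close> prescribes only the values from 1 on; they exhaust the total
  mass.\<close>

lemma geometric_rv_eq_0:
  assumes "geometric_rv M p X" "0 < p" "p \<le> 1"
  shows "prob {\<omega> \<in> space M. X \<omega> = 0} = 0"
proof -
  have X[measurable]: "X \<in> measurable M (count_space UNIV)"
    using assms(1) by (simp add: geometric_rv_def)
  have "(\<lambda>m. prob {\<omega> \<in> space M. X \<omega> = Suc m}) sums prob (\<Union>m. {\<omega> \<in> space M. X \<omega> = Suc m})"
    by (rule finite_measure_UNION) (auto simp: disjoint_family_on_def)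
  moreover have "prob {\<omega> \<in> space M. X \<omega> = Suc m} = p * (1 - p) ^ m" for m
    using assms(1) by (auto simp: geometric_rv_def)
  moreover have "(\<lambda>m. p * (1 - p) ^ m) sums (p * (1 / (1 - (1 - p))))"
    using assms(2,3) by (intro sums_mult geometric_sums) auto
  ultimately have "prob (\<Union>m. {\<omega> \<in> space M. X \<omega> = Suc m}) = 1"
    using sums_unique2 assms(2) by fastforce
  moreover have "{\<omega> \<in> space M. X \<omega> = 0} = space M - (\<Union>m. {\<omega> \<in> space M. X \<omega> = Suc m})"
    by (auto intro: ccontr simp: gr0_conv_Suc)
  ultimately show ?thesis by (simp add: prob_compl)
qed

lemma prob_add_geometric_rv_le:
  fixes S :: "'a \<Rightarrow> nat"
  assumes X: "geometric_rv M p X" "0 < p" "p \<le> 1"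
    and indep: "indep_var (count_space UNIV) X (count_space UNIV) S"
  shows "prob {\<omega> \<in> space M. X \<omega> + S \<omega> \<le> r}
    = (\<Sum>m<r. p * (1 - p) ^ m * prob {\<omega> \<in> space M. S \<omega> \<le> r - Suc m})"
proof -
  have [measurable]: "X \<in> measurable M (count_space UNIV)" "S \<in> measurable M (count_space UNIV)"
    using indep by (auto dest: indep_var_rv1 indep_var_rv2)
  have prob_eq: "prob {\<omega> \<in> space M. X \<omega> = m \<and> S \<omega> \<le> r - m}
      = prob {\<omega> \<in> space M. X \<omega> = m} * prob {\<omega> \<in> space M. S \<omega> \<le> r - m}" for m
    \<comment> \<open>Below, \<open>m\<close> runs over \<open>{..r}\<close> only, where the
      truncated \<open>r - m\<close> is the true difference.\<close>
    using indep_varD[OF indep, of "{m}" "{..r - m}"] by (simp add: vimage_def Int_def conj_ac)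
  have "{\<omega> \<in> space M. X \<omega> + S \<omega> \<le> r} = (\<Union>m\<in>{..r}. {\<omega> \<in> space M. X \<omega> = m \<and> S \<omega> \<le> r - m})"
    by auto
  then have "prob {\<omega> \<in> space M. X \<omega> + S \<omega> \<le> r}
      = (\<Sum>m\<in>{..r}. prob {\<omega> \<in> space M. X \<omega> = m \<and> S \<omega> \<le> r - m})"
    by (simp only:) (intro finite_measure_finite_Union, auto simp: disjoint_family_on_def)
  also have "\<dots> = (\<Sum>m<r. prob {\<omega> \<in> space M. X \<omega> = Suc m} * prob {\<omega> \<in> space M. S \<omega> \<le> r - Suc m})"
    by (simp add: prob_eq geometric_rv_eq_0[OF X] sum.atMost_shift)
  also have "\<dots> = (\<Sum>m<r. p * (1 - p) ^ m * prob {\<omega> \<in> space M. S \<omega> \<le> r - Suc m})"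
    using X(1) by (auto simp: geometric_rv_def)
  finally show ?thesis .
qed

text \<open>Conditioning on the first trial: success uses one time unit and leaves \<open>S\<close>,
  failure restarts \<open>X\<close> with one unit less. In the sum, the term for
  \<open>m = 0\<close> is split off and \<open>1 - p\<close> factored from the rest.\<close>

lemma prob_add_geometric_rv_le_Suc:
  fixes S :: "'a \<Rightarrow> nat"
  assumes "geometric_rv M p X" "0 < p" "p \<le> 1"
    and "indep_var (count_space UNIV) X (count_space UNIV) S"
  shows "prob {\<omega> \<in> space M. X \<omega> + S \<omega> \<le> Suc r}
    = p * prob {\<omega> \<in> space M. S \<omega> \<le> r} + (1 - p) * prob {\<omega> \<in> space M. X \<omega> + S \<omega> \<le> r}"
  unfolding prob_add_geometric_rv_le[OF assms] sum.lessThan_Suc_shift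
  by (simp add: sum_distrib_left mult_ac)

text \<open>The restrictions of the family to the disjoint index sets \<open>{i}\<close> and
  \<open>J\<close> are independent; evaluation and summation are applied to them.\<close>

lemma indep_var_nat_sum:
  fixes X :: "'i \<Rightarrow> 'a \<Rightarrow> nat"
  assumes "indep_vars (\<lambda>_. count_space UNIV) X I" "i \<in> I" "J \<subseteq> I" "i \<notin> J"
  shows "indep_var (count_space UNIV) (X i) (count_space UNIV) (\<lambda>\<omega>. \<Sum>j\<in>J. X j \<omega>)"
proof -
  have "indep_var (count_space UNIV) ((\<lambda>f. f i) \<circ> (\<lambda>\<omega>. restrict (\<lambda>j. X j \<omega>) {i}))
      (count_space UNIV) ((\<lambda>f. \<Sum>j\<in>J. f j) \<circ> (\<lambda>\<omega>. restrict (\<lambda>j. X j \<omega>) J))"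
    using assms by (intro indep_var_compose[OF indep_var_restrict[OF assms(1)]]) auto
  then show ?thesis by (simp add: o_def)
qed

end

theorem corollary7p4:
  fixes \<theta> \<alpha> :: real and n r :: nat
    and M :: "'a measure" and X :: "nat \<Rightarrow> 'a \<Rightarrow> nat"
  assumes "\<theta> > 0" and "0 \<le> \<alpha>" and "\<alpha> < 1" and "n \<ge> 1"
    and "prob_space M"
    and "prob_space.indep_vars M (\<lambda>_. count_space UNIV) X {2..n}"
    and "\<And>i. i \<in> {2..n} \<Longrightarrow>
      geometric_rv M (real i * (\<theta> + real i - 1) / (real n * (\<theta> + real n - 1))) (X i)"
  shows "max_separation (partitions n) (down_up_walk \<theta> \<alpha> n) (pitman \<theta> \<alpha> n) r
    = measure M {\<omega> \<in> space M. (\<Sum>i\<in>{2..n}. X i \<omega>) > r}"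
proof -
  interpret prob_space M by fact
  \<comment> \<open>The distribution function of the partial sum up to \<open>i\<close>; for
    \<open>i = 1\<close> the sum is empty, whence \<open>F 1 r = 1\<close>.\<close>
  define F where "F i r = prob {\<omega> \<in> space M. (\<Sum>j\<in>{2..i}. X j \<omega>) \<le> r}" for i r
  have geometric: "geometric_rv M (step_prob \<theta> n i) (X i)" if "2 \<le> i" "i \<le> n" for i
    using assms(7)[of i] that by (simp add: step_prob_def)
  have bounds: "0 < step_prob \<theta> n i" "step_prob \<theta> n i \<le> 1" if "2 \<le> i" "i \<le> n" for i
    using step_prob_bounds[OF assms(1), of i n] that by auto
  have split: "(\<Sum>j\<in>{2..i}. X j \<omega>) = X i \<omega> + (\<Sum>j\<in>{2..i - 1}. X j \<omega>)" if "2 \<le> i" for i \<omega>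
    using that by (cases i) (simp_all add: add.commute)
  have indep: "indep_var (count_space UNIV) (X i) (count_space UNIV) (\<lambda>\<omega>. \<Sum>j\<in>{2..i - 1}. X j \<omega>)"
    if "2 \<le> i" "i \<le> n" for i
    using that by (intro indep_var_nat_sum[OF assms(6)]) auto
  have "max_separation (partitions n) (down_up_walk \<theta> \<alpha> n) (pitman \<theta> \<alpha> n) r = 1 - F n r"
  proof (rule max_separation_down_up_walk[OF assms(1-4)])
    show "F 1 r = 1" for r
      by (simp add: F_def prob_space)
    \<comment> \<open>At \<open>r = 0\<close> the sum over the values of \<open>X i\<close> is
      empty, as \<open>X i\<close> is almost surely at least 1.\<close>
    show "F i 0 = 0" if "2 \<le> i" "i \<le> n" for i
      using prob_add_geometric_rv_le[OF geometric bounds indep, of i 0] that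
      unfolding F_def split[OF that(1)] by simp
    show "F i (Suc r) = step_prob \<theta> n i * F (i - 1) r + (1 - step_prob \<theta> n i) * F i r"
      if "2 \<le> i" "i \<le> n" for i r
      using prob_add_geometric_rv_le_Suc[OF geometric bounds indep, of i r] that
      unfolding F_def split[OF that(1)] by simp
  qed
  also have "\<dots> = prob {\<omega> \<in> space M. (\<Sum>i\<in>{2..n}. X i \<omega>) > r}"
  proof -
    have [measurable]: "X i \<in> measurable M (count_space UNIV)" if "i \<in> {2..n}" for i
      using assms(7)[OF that] by (simp add: geometric_rv_def)
    have "{\<omega> \<in> space M. (\<Sum>i\<in>{2..n}. X i \<omega>) > r}
        = space M - {\<omega> \<in> space M. (\<Sum>i\<in>{2..n}. X i \<omega>) \<le> r}" by auto
    moreover have "{\<omega> \<in> space M. (\<Sum>i\<in>{2..n}. X i \<omega>) \<le> r} \<in> events" by measurable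
    ultimately show ?thesis by (simp add: F_def prob_compl)
  qed
  finally show ?thesis .
qed

end
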